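(* Let $\Gamma$ be a smooth, strictly convex, closed curve of length $2\pi$ in the plane, with curvature $\kappa(s)$ as a function of arc length $s$, and let $\lambda_\Gamma$ be the lowest eigenvalue of the Schrödinger operator $H_\Gamma = -\frac{d^2}{ds^2} + \kappa(s)^2$ in $L^2([0,2\pi))$ with periodic boundary conditions. Then $$\lambda_\Gamma > \left(1+\frac{1}{1+8/\pi}\right)^{-2} > 0.6084.$$
   Context: Let $\Omega := \mathbb{R}/2\pi\mathbb{Z}$. For a smooth closed plane curve $\Gamma$ of length $2\pi$ parametrized by arc length $s\in\Omega$, let $\phi(s)$ be the angle between the tangent of $\Gamma$ at $s$ and a fixed axis, so that the tangent vector is $(\cos\phi(s),\sin\phi(s))$ and $\phi'(s)=\kappa(s)$ is the curvature. Strictly convex means (with suitable orientation) $\phi'>0$ everywhere, with total turning $\int_\Omega \phi'(s)\,ds = 2\pi$; closedness means $\int_\Omega\cos\phi(s)\,ds=\int_\Omega\sin\phi(s)\,ds=0$. Equivalently, $\lambda_\Gamma$ is the minimum of $\int_\Omega (R'(s)^2+\kappa(s)^2R(s)^2)\,ds \big/ \int_\Omega R(s)^2\,ds$ over nonzero $2\pi$-periodic $R$ in the Sobolev space $H^1(\Omega)$. *)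

theory Defs
  imports "HOL-Analysis.Analysis"
begin

definition C_infinity :: "(real \<Rightarrow> 'a::real_normed_vector) \<Rightarrow> bool" where
  "C_infinity f \<longleftrightarrow>
     (\<forall>n. ((\<lambda>g t. vector_derivative g (at t)) ^^ n) f differentiable_on UNIV)"

text \<open>The derivative condition says both that \<open>\<phi>\<close> is the tangent angle and that \<open>\<Gamma>\<close> is
  parametrized by arc length. Functions on the circle \<open>\<real>/2\<pi>\<int>\<close> are represented by
  \<open>2\<pi>\<close>-periodic functions on \<open>\<real>\<close>, except that the angle \<open>\<phi>\<close>, defined only modulo \<open>2\<pi>\<close>
  on the circle, is lifted to a smooth real function which is not periodic.\<close>

definition tangent_angle :: "(real \<Rightarrow> real ^ 2) \<Rightarrow> (real \<Rightarrow> real) \<Rightarrow> bool" where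
  "tangent_angle \<Gamma> \<phi> \<longleftrightarrow> C_infinity \<phi> \<and>
     (\<forall>s. (\<Gamma> has_vector_derivative vector [cos (\<phi> s), sin (\<phi> s)]) (at s))"

definition smooth_closed_curve :: "(real \<Rightarrow> real ^ 2) \<Rightarrow> bool" where
  "smooth_closed_curve \<Gamma> \<longleftrightarrow> C_infinity \<Gamma> \<and> (\<forall>s. \<Gamma> (s + 2 * pi) = \<Gamma> s)"

text \<open>The sign \<open>\<sigma>\<close> is the orientation: \<open>1\<close> for counterclockwise, \<open>-1\<close> for clockwise.\<close>

definition strictly_convex :: "(real \<Rightarrow> real) \<Rightarrow> bool" where
  "strictly_convex \<kappa> \<longleftrightarrow>
     (\<exists>\<sigma>\<in>{1, -1}. (\<forall>s. 0 < \<sigma> * \<kappa> s) \<and>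
        ((\<lambda>s. \<sigma> * \<kappa> s) has_integral 2 * pi) {0..2 * pi})"

definition square_integrable :: "(real \<Rightarrow> real) \<Rightarrow> bool" where
  "square_integrable f \<longleftrightarrow>
     set_borel_measurable lebesgue {0..2 * pi} f \<and>
     set_integrable lebesgue {0..2 * pi} (\<lambda>t. (f t)\<^sup>2)"

text \<open>The graph of \<open>H = -d\<^sup>2/ds\<^sup>2 + \<kappa>\<^sup>2\<close> in \<open>L\<^sup>2([0,2\<pi>))\<close>: \<open>u\<close> lies in the domain and \<open>H u = f\<close>.
  The domain is the periodic Sobolev space \<open>H\<^sup>2\<close>. An element is represented by its
  \<open>C\<^sup>1\<close> representative \<open>u\<close> on the closed interval; \<open>v = u'\<close> is absolutely continuous with
  square integrable derivative \<open>w = u''\<close>, and \<open>u\<close>, \<open>v\<close> satisfy the periodic boundary conditions.\<close>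

definition schroedinger :: "(real \<Rightarrow> real) \<Rightarrow> (real \<Rightarrow> real) \<Rightarrow> (real \<Rightarrow> real) \<Rightarrow> bool" where
  "schroedinger \<kappa> u f \<longleftrightarrow>
     (\<exists>v w. square_integrable w \<and>
        (\<forall>t\<in>{0..2 * pi}. (u has_real_derivative v t) (at t within {0..2 * pi})) \<and>
        (\<forall>t\<in>{0..2 * pi}. v t = v 0 + (LINT x:{0..t}|lebesgue. w x)) \<and>
        u 0 = u (2 * pi) \<and> v 0 = v (2 * pi) \<and>
        (AE t in lebesgue. t \<in> {0..2 * pi} \<longrightarrow> f t = - w t + (\<kappa> t)\<^sup>2 * u t))"

text \<open>Eigenfunctions are continuous, so being nonzero in \<open>L\<^sup>2\<close> means being nonzero at some point.\<close>

definition schroedinger_eigenvalue :: "(real \<Rightarrow> real) \<Rightarrow> real \<Rightarrow> bool" where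
  "schroedinger_eigenvalue \<kappa> \<mu> \<longleftrightarrow>
     (\<exists>u. (\<exists>t\<in>{0..2 * pi}. u t \<noteq> 0) \<and> schroedinger \<kappa> u (\<lambda>t. \<mu> * u t))"

definition lowest_eigenvalue :: "(real \<Rightarrow> real) \<Rightarrow> real \<Rightarrow> bool" where
  "lowest_eigenvalue \<kappa> \<mu> \<longleftrightarrow>
     schroedinger_eigenvalue \<kappa> \<mu> \<and> (\<forall>\<nu>. schroedinger_eigenvalue \<kappa> \<nu> \<longrightarrow> \<mu> \<le> \<nu>)"

end

(* Let u be an eigenfunction for nu < mu^2 and y = u sin(phi - theta). The integral of
   y'^2 - mu^2 y^2 is P/2 plus a multiple of cos(2 (theta - theta0)), where
   P = (nu - mu^2) * (integral of u^2) < 0; hence it is negative for all theta in some interval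
   of length pi/2. On the other hand y vanishes where the tangent has direction theta or
   theta + pi, so if both arcs between these points have length less than pi/mu, the Dirichlet
   inequality makes the integral nonnegative. It remains to find such a theta in every interval
   of length pi/2: otherwise the excess of the arc from theta to theta + pi over pi keeps its
   sign and stays large on the interval, and then the curve does not close up within length
   2 pi. This already works for mu = 4/5, which gives the eigenvalue bound 16/25. *)

theory Submission
  imports Defs
begin

section \<open>Tangent angle as a coordinate, and arcs between antiparallel tangents\<close>

text \<open>Only the turning of the tangent is recorded here. That the curve closes up enters
  separately, through periodic coordinate functions, so that the locale is stable under rotating the
  plane.\<close>

locale turning_angle =
  fixes \<psi> k :: "real \<Rightarrow> real"
  assumes deriv: "(\<psi> has_real_derivative k s) (at s)"
    and pos: "0 < k s"
    and turn: "\<psi> (s + 2 * pi) = \<psi> s + 2 * pi"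
begin

definition \<sigma> :: "real \<Rightarrow> real" where "\<sigma> = inv \<psi>"

text \<open>\<open>\<sigma>\<close> gives the arc length at which the tangent has a prescribed
  angle. The two points with tangent angles \<open>\<theta>\<close> and \<open>\<theta> + pi\<close>
  halve the curve exactly when this is zero.\<close>

definition excess :: "real \<Rightarrow> real" where "excess \<theta> = \<sigma> (\<theta> + pi) - \<sigma> \<theta> - pi"

lemma strict_mono_\<psi>: "strict_mono \<psi>"
  using DERIV_pos_imp_increasing[of _ _ \<psi>] deriv pos by (metis strict_monoI)

lemma turn_nat: "\<psi> (s + 2 * pi * real n) = \<psi> s + 2 * pi * real n"
proof (induction n)
  case (Suc n)
  then show ?case using turn[of "s + 2 * pi * real n"] by (simp add: algebra_simps)
qed simp

lemma isCont_\<psi>: "isCont \<psi> s"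
  using deriv DERIV_isCont by blast

text \<open>Whole turns make \<open>\<psi>\<close> unbounded in both directions; continuity fills
  the gaps.\<close>

lemma surj_\<psi>: "surj \<psi>"
proof -
  have "\<exists>s. \<psi> s = y" for y
  proof -
    obtain n :: nat where n: "\<bar>y - \<psi> 0\<bar> \<le> real n" using real_arch_simple by blast
    have "real n \<le> 2 * pi * real n" using pi_ge_two by (simp add: mult_le_cancel_right1)
    moreover have "\<psi> (2 * pi * real n) = \<psi> 0 + 2 * pi * real n"
      using turn_nat[of 0 n] by simp
    moreover have "\<psi> (- (2 * pi * real n)) = \<psi> 0 - 2 * pi * real n"
      using turn_nat[of "- (2 * pi * real n)" n] by simp
    ultimately have "\<psi> (- (2 * pi * real n)) \<le> y" "y \<le> \<psi> (2 * pi * real n)"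
      using n by linarith+
    moreover have "- (2 * pi * real n) \<le> 2 * pi * real n" by simp
    ultimately show ?thesis using IVT[of \<psi>] isCont_\<psi> by blast
  qed
  then show ?thesis by (metis surj_def)
qed

lemma \<psi>_\<sigma> [simp]: "\<psi> (\<sigma> \<theta>) = \<theta>"
  unfolding \<sigma>_def using surj_\<psi> by (rule surj_f_inv_f)

lemma \<sigma>_\<psi> [simp]: "\<sigma> (\<psi> s) = s"
  unfolding \<sigma>_def using strict_mono_imp_inj_on[OF strict_mono_\<psi>] by (rule inv_f_f)

lemma \<sigma>_less_iff: "\<sigma> x < \<sigma> y \<longleftrightarrow> x < y"
  using strict_mono_less[OF strict_mono_\<psi>, of "\<sigma> x" "\<sigma> y"] by simp

lemma \<sigma>_le_iff: "\<sigma> x \<le> \<sigma> y \<longleftrightarrow> x \<le> y"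
  using \<sigma>_less_iff[of y x] by linarith

lemma \<sigma>_turn: "\<sigma> (\<theta> + 2 * pi) = \<sigma> \<theta> + 2 * pi"
  using \<sigma>_\<psi>[of "\<sigma> \<theta> + 2 * pi"] by (simp add: turn)

lemma isCont_\<sigma>: "isCont \<sigma> \<theta>"
  using isCont_inverse_function[of 1 "\<sigma> \<theta>" \<sigma> \<psi>] isCont_\<psi> by simp

lemma deriv_\<sigma>: "(\<sigma> has_real_derivative inverse (k (\<sigma> \<theta>))) (at \<theta>)"
proof (rule DERIV_inverse_function)
  show "(\<psi> has_real_derivative k (\<sigma> \<theta>)) (at (\<sigma> \<theta>))" by (rule deriv)
  show "k (\<sigma> \<theta>) \<noteq> 0" using pos[of "\<sigma> \<theta>"] by simp
  show "\<theta> - 1 < \<theta>" "\<theta> < \<theta> + 1" by simp_all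
qed (simp_all add: isCont_\<sigma>)

text \<open>The arcs belonging to \<open>\<theta>\<close> and \<open>\<theta> + pi\<close> make up
  the whole curve, so one is as much too long as the other is too short.\<close>

lemma excess_pi: "excess (\<theta> + pi) = - excess \<theta>"
  using \<sigma>_turn[of \<theta>] by (simp add: excess_def algebra_simps)

lemma abs_excess_int: "\<bar>excess (\<theta> + of_int n * pi)\<bar> = \<bar>excess \<theta>\<bar>"
proof (induction n rule: int_induct[of _ 0])
  case (step1 i)
  then show ?case using excess_pi[of "\<theta> + of_int i * pi"] by (simp add: algebra_simps)
next
  case (step2 i)
  then show ?case using excess_pi[of "\<theta> + of_int (i - 1) * pi"] by (simp add: algebra_simps)
qed simp

lemma continuous_on_excess: "continuous_on S excess"
proof -
  have c: "continuous_on UNIV \<sigma>" using isCont_\<sigma> by (simp add: continuous_at_imp_continuous_on)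
  have "continuous_on UNIV (\<lambda>x. \<sigma> (x + pi))"
    by (intro continuous_on_compose2[OF c] continuous_intros) auto
  then have "continuous_on UNIV excess"
    unfolding excess_def by (intro continuous_intros c) auto
  then show ?thesis using continuous_on_subset by blast
qed

text \<open>This is a rotation of the plane; it moves any interval of directions to one centred at
  0.\<close>

lemma turning_angle_shift: "turning_angle (\<lambda>s. \<psi> s - c) k"
  by unfold_locales (auto intro!: derivative_eq_intros deriv pos simp: turn)

text \<open>The point \<open>\<sigma> \<theta>\<close> may lie outside the period
  \<open>[0, 2 * pi]\<close>. Adding a multiple of \<pi> to \<open>\<theta>\<close> moves it inside,
  and changes neither the zeros of the sine nor the absolute value of the excess.\<close>

lemma arcs_in_period:
  obtains a b where "0 \<le> a" "a \<le> b" "b \<le> 2 * pi" "sin (\<psi> a - \<theta>) = 0" "sin (\<psi> b - \<theta>) = 0"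
    "\<bar>b - a - pi\<bar> = \<bar>excess \<theta>\<bar>"
proof -
  \<comment> \<open>\<open>x\<close> is the first angle congruent to \<open>\<theta>\<close> modulo
    \<pi> that is not below \<open>\<psi> 0\<close>; hence \<open>x + pi\<close> is still below
    \<open>\<psi> 0 + 2 * pi\<close>.\<close>
  define n where "n = \<lceil>(\<psi> 0 - \<theta>) / pi\<rceil>"
  define x where "x = \<theta> + of_int n * pi"
  have "(\<psi> 0 - \<theta>) / pi \<le> of_int n" "of_int n - 1 < (\<psi> 0 - \<theta>) / pi"
    unfolding n_def by linarith+
  then have x: "\<psi> 0 \<le> x" "x - pi < \<psi> 0"
    by (auto simp: x_def field_simps)
  have a0: "0 \<le> \<sigma> x" using x(1) \<sigma>_le_iff[of "\<psi> 0" x] by simp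
  have "\<sigma> (x - pi) < 0" using x(2) \<sigma>_less_iff[of "x - pi" "\<psi> 0"] by simp
  then have b1: "\<sigma> (x + pi) \<le> 2 * pi" using \<sigma>_turn[of "x - pi"] by (simp add: add.commute)
  have "sin (of_int n * pi) = 0" using sin_zero_iff_int2 by blast
  then have "sin (x - \<theta>) = 0" by (simp add: x_def)
  moreover from this have "sin (x + pi - \<theta>) = 0"
    using sin_periodic_pi[of "x - \<theta>"] by (simp add: algebra_simps)
  moreover have "\<bar>\<sigma> (x + pi) - \<sigma> x - pi\<bar> = \<bar>excess \<theta>\<bar>"
    using abs_excess_int[of \<theta> n] by (simp add: x_def excess_def)
  moreover have "\<sigma> x \<le> \<sigma> (x + pi)" by (simp add: \<sigma>_le_iff)
  ultimately show ?thesis using that[of "\<sigma> x" "\<sigma> (x + pi)"] a0 b1 by simp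
qed

section \<open>Closedness prevents a large excess on a quarter turn\<close>

text \<open>In \<open>P\<close> the derivatives of \<open>\<sigma>\<close> cancel, because the tangents at \<open>\<theta>\<close> and \<open>\<theta> + \<pi>\<close> are opposite.\<close>

lemma not_large_excess:
  assumes Y: "\<And>s. (Y has_real_derivative sin (\<psi> s)) (at s)"
    and per: "\<And>s. Y (s + 2 * pi) = Y s"
    and big: "\<And>\<theta>. \<bar>\<theta>\<bar> \<le> pi / 4 \<Longrightarrow> 3 / 4 \<le> excess \<theta>"
  shows False
proof -
  \<comment> \<open>\<open>m\<close> is the assumed lower bound of the excess. \<open>r\<close> is
    the sine of \<pi>/4, hence the least slope of \<open>Y\<close> for tangent angles from \<pi>/4
    to 3\<pi>/4.\<close>
  define m r where "m = (3/4 :: real)" and "r = sqrt 2 / 2"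
  have r: "7/10 \<le> r" "r \<le> 71/100"
    using real_le_rsqrt[of "7/5" 2] real_le_lsqrt[of "71/50" 2]
    by (auto simp: r_def power2_eq_square)
  define P where "P = (\<lambda>\<theta>. Y (\<sigma> \<theta>) + Y (\<sigma> (\<theta> + pi)) + sin \<theta> * (excess \<theta> - m))"
  have d\<sigma>: "((\<lambda>x. \<sigma> (x + pi)) has_real_derivative inverse (k (\<sigma> (\<theta> + pi)))) (at \<theta>)" for \<theta>
    using DERIV_shift deriv_\<sigma> by blast
  have dP: "(P has_real_derivative cos \<theta> * (excess \<theta> - m)) (at \<theta>)" for \<theta>
  proof -
    have "(excess has_real_derivative inverse (k (\<sigma> (\<theta> + pi))) - inverse (k (\<sigma> \<theta>))) (at \<theta>)"
      unfolding excess_def by (auto intro!: derivative_eq_intros d\<sigma> deriv_\<sigma>)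
    moreover have "((\<lambda>x. Y (\<sigma> x)) has_real_derivative sin \<theta> * inverse (k (\<sigma> \<theta>))) (at \<theta>)"
      using DERIV_chain2[OF Y deriv_\<sigma>] by simp
    moreover have "((\<lambda>x. Y (\<sigma> (x + pi))) has_real_derivative
        - sin \<theta> * inverse (k (\<sigma> (\<theta> + pi)))) (at \<theta>)"
      using DERIV_chain2[OF Y d\<sigma>, of \<theta>] by simp
    ultimately show ?thesis unfolding P_def
      by (auto intro!: derivative_eq_intros simp: algebra_simps)
  qed
  have "P (- (pi/4)) \<le> P (pi/4)"
  proof (rule DERIV_nonneg_imp_nondecreasing[where f = P])
    fix x assume x: "- (pi/4) \<le> x" "x \<le> pi/4"
    then have "0 \<le> cos x" by (intro cos_ge_zero) auto
    moreover have "m \<le> excess x" using big[of x] x by (simp add: m_def abs_le_iff)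
    ultimately have "0 \<le> cos x * (excess x - m)" by simp
    then show "\<exists>y. (P has_real_derivative y) (at x) \<and> 0 \<le> y" using dP by blast
  qed simp
  \<comment> \<open>These points cut the curve into four arcs. Monotonicity of \<open>P\<close>
    compares \<open>Y\<close> at the four points. From \<open>s2\<close> to \<open>t1\<close> the
    height \<open>Y\<close> rises at rate at least \<open>r\<close>; from \<open>t2\<close> to
    \<open>s1 + 2 * pi\<close> it falls at rate at most 1.\<close>
  define s1 s2 t1 t2 where "s1 = \<sigma> (- (pi/4))" and "s2 = \<sigma> (pi/4)"
    and "t1 = \<sigma> (3*pi/4)" and "t2 = \<sigma> (5*pi/4)"
  define F G where "F = excess (pi/4)" and "G = excess (- (pi/4))"
  have FG: "F = t2 - s2 - pi" "G = t1 - s1 - pi"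
    unfolding F_def G_def excess_def s1_def s2_def t1_def t2_def by (simp_all add: algebra_simps)
  have FGm: "m \<le> F" "m \<le> G" unfolding F_def G_def m_def by (rule big, simp)+
  have ord: "s1 \<le> s2" "s2 \<le> t1" "t1 \<le> t2" "t2 \<le> s1 + 2 * pi"
    using \<sigma>_turn[of "-(pi/4)"]
    by (auto simp: s1_def s2_def t1_def t2_def \<sigma>_le_iff simp flip: \<sigma>_turn)
  have "Y s1 + Y t1 - r * (G - m) \<le> Y s2 + Y t2 + r * (F - m)"
    using \<open>P (- (pi/4)) \<le> P (pi/4)\<close>
    by (simp add: P_def s1_def s2_def t1_def t2_def F_def G_def r_def sin_45 algebra_simps)
  moreover have "Y s2 - r * s2 \<le> Y t1 - r * t1"
  proof (rule DERIV_nonneg_imp_nondecreasing[OF ord(2), where f = "\<lambda>a. Y a - r * a"])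
    fix s assume s: "s2 \<le> s" "s \<le> t1"
    then have "\<sigma> (pi/4) \<le> \<sigma> (\<psi> s)" "\<sigma> (\<psi> s) \<le> \<sigma> (3*pi/4)" by (auto simp: s2_def t1_def)
    then have p: "pi/4 \<le> \<psi> s" "\<psi> s \<le> 3*pi/4" by (auto simp only: \<sigma>_le_iff)
    have "cos (pi/4) \<le> cos (\<psi> s - pi/2)"
      using cos_monotone_0_pi_le[of "\<bar>\<psi> s - pi/2\<bar>" "pi/4"] p
        abs_leI[of "\<psi> s - pi/2" "pi/4"] by simp
    then have "r \<le> sin (\<psi> s)" by (simp add: cos_diff cos_45 r_def)
    then show "\<exists>y. ((\<lambda>a. Y a - r * a) has_real_derivative y) (at s) \<and> 0 \<le> y"
      by (intro exI[of _ "sin (\<psi> s) - r"]) (auto intro!: derivative_eq_intros Y)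
  qed
  moreover have "Y t2 + t2 \<le> Y (s1 + 2 * pi) + (s1 + 2 * pi)"
  proof (rule DERIV_nonneg_imp_nondecreasing[OF ord(4), where f = "\<lambda>a. Y a + a"])
    fix s
    show "\<exists>y. ((\<lambda>a. Y a + a) has_real_derivative y) (at s) \<and> 0 \<le> y"
    proof (intro exI conjI)
      show "((\<lambda>a. Y a + a) has_real_derivative sin (\<psi> s) + 1) (at s)"
        by (auto intro!: derivative_eq_intros Y)
      show "0 \<le> sin (\<psi> s) + 1" using sin_ge_minus_one[of "\<psi> s"] by linarith
    qed
  qed
  ultimately have le: "r * (t1 - s2) - (s1 + 2 * pi - t2) - r * (F + G) + 2 * r * m \<le> 0"
    using per[of s1] by (simp add: algebra_simps)
  define D where "D = s1 + 2 * pi - t2"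
  \<comment> \<open>The rising arc is longer than the falling arc, of length \<open>D\<close>, by
    \<open>F + G\<close>. This cancels \<open>F + G\<close> in \<open>le\<close>, and what remains
    forces \<open>D\<close> to be at least 14/3 times \<open>m\<close>, that is 7/2. Both arcs
    together would then have length at least 17/2, more than 2\<pi>.\<close>
  have B: "t1 - s2 = D + F + G" using FG by (simp add: D_def)
  have "2 * r * m \<le> (1 - r) * D"
    using le[unfolded B, folded D_def] by (simp add: algebra_simps)
  moreover have "(1 - r) * D \<le> 3/10 * D"
    using r ord(4) by (intro mult_right_mono) (auto simp: D_def)
  moreover have "7/10 * m \<le> r * m" using r by (simp add: m_def)
  ultimately have "7/5 * m \<le> 3/10 * D" by simp
  moreover have "D + (t1 - s2) \<le> 2 * pi" using ord by (simp add: D_def)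
  ultimately show False using B FGm pi_approx(2) by (simp add: m_def)
qed

text \<open>Otherwise the excess has constant sign on the interval. If it is positive, rotating the
  centre to 0 contradicts \<open>not_large_excess\<close>; if it is negative, the interval moved by
  \<pi> has positive excess.\<close>

lemma ex_small_excess:
  assumes X: "\<And>s. (X has_real_derivative cos (\<psi> s)) (at s)"
    and Y: "\<And>s. (Y has_real_derivative sin (\<psi> s)) (at s)"
    and perX: "\<And>s. X (s + 2 * pi) = X s"
    and perY: "\<And>s. Y (s + 2 * pi) = Y s"
  shows "\<exists>\<theta>. \<bar>\<theta> - c\<bar> \<le> pi / 4 \<and> \<bar>excess \<theta>\<bar> \<le> 3 / 4"
proof (rule ccontr)
  assume neg: "\<not> ?thesis"
  have no: False if big: "\<And>\<theta>. \<bar>\<theta> - d\<bar> \<le> pi / 4 \<Longrightarrow> 3 / 4 \<le> excess \<theta>" for d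
  proof -
    interpret r: turning_angle "\<lambda>s. \<psi> s - d" k by (rule turning_angle_shift)
    have \<sigma>r: "r.\<sigma> \<theta> = \<sigma> (\<theta> + d)" for \<theta>
      using r.\<sigma>_\<psi>[of "\<sigma> (\<theta> + d)"] by simp
    show False
    proof (rule r.not_large_excess)
      \<comment> \<open>This is the second coordinate of the curve rotated by the angle
        \<open>- d\<close>.\<close>
      show "((\<lambda>s. cos d * Y s - sin d * X s) has_real_derivative sin (\<psi> s - d)) (at s)" for s
        by (auto intro!: derivative_eq_intros X Y simp: sin_diff algebra_simps)
      show "3 / 4 \<le> r.excess \<theta>" if "\<bar>\<theta>\<bar> \<le> pi / 4" for \<theta>
        using big[of "\<theta> + d"] that by (simp add: r.excess_def \<sigma>r excess_def algebra_simps)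
    qed (simp add: perX perY)
  qed
  have big: "3 / 4 < \<bar>excess \<theta>\<bar>" if "\<bar>\<theta> - c\<bar> \<le> pi / 4" for \<theta>
    using neg that by force
  \<comment> \<open>A continuous function that avoids 0 on an interval cannot change sign
    there.\<close>
  have "connected (excess ` cball c (pi/4))"
    by (intro connected_continuous_image continuous_on_excess) simp
  moreover have "0 \<notin> excess ` cball c (pi/4)"
    using big by (force simp: dist_real_def abs_minus_commute)
  ultimately consider "\<And>\<theta>. \<bar>\<theta> - c\<bar> \<le> pi / 4 \<Longrightarrow> 0 < excess \<theta>"
    | "\<And>\<theta>. \<bar>\<theta> - c\<bar> \<le> pi / 4 \<Longrightarrow> excess \<theta> < 0"
  proof -
    assume conn: "connected (excess ` cball c (pi/4))" and nz: "0 \<notin> excess ` cball c (pi/4)"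
    have "0 < excess y" if "0 < excess x" "\<bar>x - c\<bar> \<le> pi/4" "\<bar>y - c\<bar> \<le> pi/4" for x y
    proof (rule ccontr)
      assume "\<not> 0 < excess y"
      then have "0 \<in> excess ` cball c (pi/4)"
        using connectedD_interval[OF conn, of "excess y" "excess x" 0] that
        by (simp add: dist_real_def abs_minus_commute)
      then show False using nz by simp
    qed
    moreover have "excess \<theta> \<noteq> 0" if "\<bar>\<theta> - c\<bar> \<le> pi / 4" for \<theta>
      using big[OF that] by auto
    ultimately show thesis using that by (metis linorder_neqE_linordered_idom)
  qed
  then show False
  proof cases
    case 1
    show False by (rule no[of c]) (use 1 big in force)
  next
    case 2
    show False
    proof (rule no[of "c + pi"])
      fix \<theta> assume "\<bar>\<theta> - (c + pi)\<bar> \<le> pi / 4"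
      then have "\<bar>\<theta> - pi - c\<bar> \<le> pi / 4" by (simp add: algebra_simps)
      then show "3 / 4 \<le> excess \<theta>" using 2 big excess_pi[of "\<theta> - pi"] by force
    qed
  qed
qed

end


section \<open>Dirichlet inequality on two complementary arcs\<close>

text \<open>Completing the square: the difference of the integrand and the derivative of
  \<open>- \<mu> * tan (\<mu> * (s - c)) * (y s)\<^sup>2\<close> is a square.\<close>

lemma tan_weight_bound:
  fixes y y' :: "real \<Rightarrow> real"
  assumes "p \<le> q"
    and y: "\<And>s. s \<in> {p..q} \<Longrightarrow> (y has_real_derivative y' s) (at s within {p..q})"
    and cont: "continuous_on {p..q} y'"
    and small: "\<And>s. s \<in> {p..q} \<Longrightarrow> \<bar>\<mu> * (s - c)\<bar> < pi / 2"
  shows "\<mu> * tan (\<mu> * (p - c)) * (y p)\<^sup>2 - \<mu> * tan (\<mu> * (q - c)) * (y q)\<^sup>2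
    \<le> integral {p..q} (\<lambda>s. (y' s)\<^sup>2 - \<mu>\<^sup>2 * (y s)\<^sup>2)"
proof -
  define T where "T = (\<lambda>s. tan (\<mu> * (s - c)))"
  define g where "g = (\<lambda>s. - \<mu>\<^sup>2 * (1 + (T s)\<^sup>2) * (y s)\<^sup>2 - 2 * \<mu> * T s * y s * y' s)"
  have cos: "cos (\<mu> * (s - c)) \<noteq> 0" if "s \<in> {p..q}" for s
    using cos_gt_zero_pi[of "\<mu> * (s - c)"] small[OF that] by linarith
  have T: "(T has_real_derivative \<mu> * (1 + (T s)\<^sup>2)) (at s within {p..q})" if "s \<in> {p..q}" for s
    unfolding T_def using cos[OF that]
    by (auto intro!: derivative_eq_intros simp: tan_sec divide_simps)
  have "((\<lambda>s. - \<mu> * T s * (y s)\<^sup>2) has_real_derivative g s) (at s within {p..q})"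
    if "s \<in> {p..q}" for s
    unfolding g_def
    by (auto intro!: derivative_eq_intros T[OF that] y[OF that] simp: power2_eq_square algebra_simps)
  then have g: "(g has_integral - \<mu> * T q * (y q)\<^sup>2 - (- \<mu> * T p * (y p)\<^sup>2)) {p..q}"
    using \<open>p \<le> q\<close>
    by (intro fundamental_theorem_of_calculus) (auto simp: has_real_derivative_iff_has_vector_derivative)
  have conty: "continuous_on {p..q} y" using y by (rule DERIV_continuous_on)
  have "(\<lambda>s. (y' s)\<^sup>2 - \<mu>\<^sup>2 * (y s)\<^sup>2) integrable_on {p..q}"
    by (intro integrable_continuous_real continuous_intros cont conty)
  then have "- \<mu> * T q * (y q)\<^sup>2 - (- \<mu> * T p * (y p)\<^sup>2)
      \<le> integral {p..q} (\<lambda>s. (y' s)\<^sup>2 - \<mu>\<^sup>2 * (y s)\<^sup>2)"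
  proof (rule has_integral_le[OF g integrable_integral])
    fix s
    have "0 \<le> (y' s + \<mu> * T s * y s)\<^sup>2" by simp
    then show "g s \<le> (y' s)\<^sup>2 - \<mu>\<^sup>2 * (y s)\<^sup>2"
      by (simp add: g_def power2_eq_square algebra_simps)
  qed
  then show ?thesis by (simp add: T_def)
qed

text \<open>The tangent weight is centred at the midpoint of each arc. The boundary terms at
  \<open>a\<close> and \<open>b\<close> vanish with \<open>y\<close>. The second arc runs through
  the identified points 0 and \<open>L\<close>, where the boundary terms of its two pieces cancel by
  \<open>per\<close>.\<close>

lemma two_zeros_bound:
  fixes y y' :: "real \<Rightarrow> real"
  assumes ab: "0 \<le> a" "a \<le> b" "b \<le> L"
    and y: "\<And>s. s \<in> {0..L} \<Longrightarrow> (y has_real_derivative y' s) (at s within {0..L})"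
    and cont: "continuous_on {0..L} y'"
    and zero: "y a = 0" "y b = 0"
    and per: "(y 0)\<^sup>2 = (y L)\<^sup>2"
    and \<mu>: "0 < \<mu>" "\<mu> * (b - a) < pi" "\<mu> * (L - (b - a)) < pi"
  shows "0 \<le> integral {0..L} (\<lambda>s. (y' s)\<^sup>2 - \<mu>\<^sup>2 * (y s)\<^sup>2)"
proof -
  let ?f = "\<lambda>s. (y' s)\<^sup>2 - \<mu>\<^sup>2 * (y s)\<^sup>2"
  \<comment> \<open>This is the midpoint of the arc from \<open>b - L\<close> to \<open>a\<close>.
    The piece from \<open>b\<close> to \<open>L\<close> uses the translated centre
    \<open>c + L\<close>.\<close>
  define c where "c = (a + b - L) / 2"
  have part: "\<mu> * tan (\<mu> * (p - d)) * (y p)\<^sup>2 - \<mu> * tan (\<mu> * (q - d)) * (y q)\<^sup>2 \<le> integral {p..q} ?f"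
    if pq: "0 \<le> p" "p \<le> q" "q \<le> L" and d: "\<mu> * (q - d) < pi / 2" "\<mu> * (d - p) < pi / 2" for p q d
  proof (rule tan_weight_bound)
    have sub: "{p..q} \<subseteq> {0..L}" using pq by auto
    show "(y has_real_derivative y' s) (at s within {p..q})" if "s \<in> {p..q}" for s
      using DERIV_subset[OF y sub] that sub by blast
    show "continuous_on {p..q} y'" using cont sub by (rule continuous_on_subset)
    show "\<bar>\<mu> * (s - d)\<bar> < pi / 2" if "s \<in> {p..q}" for s
    proof -
      have "\<mu> * (s - d) \<le> \<mu> * (q - d)" "\<mu> * (d - s) \<le> \<mu> * (d - p)"
        using that \<mu>(1) by auto
      moreover have "\<mu> * (d - s) = - (\<mu> * (s - d))" by (simp add: algebra_simps)
      ultimately show ?thesis using d by linarith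
    qed
  qed (use pq in auto)
  have conty: "continuous_on {0..L} y" using y by (rule DERIV_continuous_on)
  have int: "?f integrable_on {0..L}"
    by (intro integrable_continuous_real continuous_intros cont conty)
  then have int': "?f integrable_on {a..L}" by (rule integrable_on_subinterval) (use ab in auto)
  have "integral {0..L} ?f = integral {0..a} ?f + integral {a..L} ?f"
    using Henstock_Kurzweil_Integration.integral_combine[OF ab(1) _ int] ab by simp
  also have "integral {a..L} ?f = integral {a..b} ?f + integral {b..L} ?f"
    using Henstock_Kurzweil_Integration.integral_combine[OF ab(2,3) int'] by simp
  moreover have "0 \<le> integral {a..b} ?f"
    using part[of a b "(a + b) / 2"] ab \<mu> zero by (simp add: field_simps)
  moreover have "\<mu> * tan (\<mu> * (0 - c)) * (y 0)\<^sup>2 \<le> integral {0..a} ?f"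
  proof -
    have "\<mu> * (a - c) < pi / 2" using \<mu>(3) by (simp add: c_def field_simps)
    \<comment> \<open>Since \<open>b \<le> L\<close>, the piece from 0 to \<open>a\<close> lies in
      the arc from \<open>b - L\<close> to \<open>a\<close>, so no pole of the tangent is
      met.\<close>
    moreover have "\<mu> * (c - 0) \<le> \<mu> * (a - c)"
      using ab \<mu>(1) by (intro mult_left_mono) (auto simp: c_def field_simps)
    ultimately show ?thesis using part[of 0 a c] ab zero by simp
  qed
  moreover have "- (\<mu> * tan (\<mu> * (0 - c)) * (y L)\<^sup>2) \<le> integral {b..L} ?f"
  proof -
    have "\<mu> * (c + L - b) < pi / 2" using \<mu>(3) by (simp add: c_def field_simps)
    moreover have "\<mu> * (L - (c + L)) \<le> \<mu> * (c + L - b)"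
      using ab \<mu>(1) by (intro mult_left_mono) (auto simp: c_def field_simps)
    ultimately show ?thesis using part[of b L "c + L"] ab zero by simp
  qed
  ultimately show ?thesis using per by simp
qed

section \<open>Eigenfunctions and directions with a negative form\<close>

text \<open>The eigenvalue equation identifies the weak second derivative almost everywhere with a
  continuous function, so an eigenfunction solves the differential equation classically.\<close>

lemma schroedinger_eigenvalueE:
  assumes "schroedinger_eigenvalue \<kappa> \<nu>" and cont: "continuous_on {0..2 * pi} \<kappa>"
  obtains u v where "\<exists>t\<in>{0..2 * pi}. u t \<noteq> 0"
    and "\<And>t. t \<in> {0..2 * pi} \<Longrightarrow> (u has_real_derivative v t) (at t within {0..2 * pi})"
    and "\<And>t. t \<in> {0..2 * pi} \<Longrightarrow>
      (v has_real_derivative ((\<kappa> t)\<^sup>2 - \<nu>) * u t) (at t within {0..2 * pi})"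
    and "u 0 = u (2 * pi)" "v 0 = v (2 * pi)"
proof -
  obtain u v w where nz: "\<exists>t\<in>{0..2 * pi}. u t \<noteq> 0" and sq: "square_integrable w"
    and u: "\<And>t. t \<in> {0..2 * pi} \<Longrightarrow> (u has_real_derivative v t) (at t within {0..2 * pi})"
    and v: "\<And>t. t \<in> {0..2 * pi} \<Longrightarrow> v t = v 0 + (LINT x:{0..t}|lebesgue. w x)"
    and per: "u 0 = u (2 * pi)" "v 0 = v (2 * pi)"
    and ae: "AE t in lebesgue. t \<in> {0..2 * pi} \<longrightarrow> \<nu> * u t = - w t + (\<kappa> t)\<^sup>2 * u t"
    using assms(1) unfolding schroedinger_eigenvalue_def schroedinger_def by blast
  define g where "g = (\<lambda>t. ((\<kappa> t)\<^sup>2 - \<nu>) * u t)"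
  have "continuous_on {0..2 * pi} u" using u by (rule DERIV_continuous_on)
  then have g: "continuous_on {0..2 * pi} g"
    unfolding g_def by (intro continuous_intros cont)
  have v': "v t = v 0 + integral {0..t} g" if t: "t \<in> {0..2 * pi}" for t
  proof -
    have gt: "continuous_on {0..t} g" using g t continuous_on_subset by fastforce
    then have ig: "set_integrable lebesgue {0..t} g"
      using absolutely_integrable_continuous_real by blast
    have "set_borel_measurable lebesgue {0..2 * pi} w"
      using sq by (simp add: square_integrable_def)
    then have wm: "set_borel_measurable lebesgue {0..t} w"
      by (rule set_borel_measurable_subset) (use t in auto)
    have "AE x in lebesgue. x \<in> {0..t} \<longrightarrow> w x = g x"
      using ae by eventually_elim (use t in \<open>auto simp: g_def algebra_simps\<close>)
    then have "(LINT x:{0..t}|lebesgue. w x) = (LINT x:{0..t}|lebesgue. g x)"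
      using wm ig unfolding set_borel_measurable_def set_integrable_def set_lebesgue_integral_def
      by (intro integral_cong_AE) (auto elim!: eventually_mono simp: indicator_def)
    also have "\<dots> = integral {0..t} g"
      using ig by (rule set_lebesgue_integral_eq_integral(2))
    finally show ?thesis using v[OF t] by simp
  qed
  have "(v has_real_derivative ((\<kappa> t)\<^sup>2 - \<nu>) * u t) (at t within {0..2 * pi})"
    if t: "t \<in> {0..2 * pi}" for t
  proof -
    have "((\<lambda>t. v 0 + integral {0..t} g) has_real_derivative g t) (at t within {0..2 * pi})"
      using integral_has_real_derivative[OF g t] by (auto intro!: derivative_eq_intros)
    then have "(v has_real_derivative g t) (at t within {0..2 * pi})"
      unfolding has_real_derivative_iff_has_vector_derivative
      by (rule has_vector_derivative_transform[OF t, rotated]) (rule v')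
    then show ?thesis by (simp add: g_def)
  qed
  then show ?thesis using that nz u per by blast
qed

text \<open>For \<open>u\<close> as radius over the tangent angle, \<open>u s * sin (\<psi> s - \<theta>)\<close> is one coordinate of a
  plane curve, so the quadratic form \<open>J\<close> depends on \<open>\<theta>\<close> only through \<open>cos (2 * \<theta>)\<close> and
  \<open>sin (2 * \<theta>)\<close>.\<close>

lemma negative_directions:
  fixes u v \<psi> \<kappa> :: "real \<Rightarrow> real" and \<mu> :: real
  defines "J \<theta> \<equiv> integral {0..2 * pi} (\<lambda>s. (v s * sin (\<psi> s - \<theta>) + u s * (cos (\<psi> s - \<theta>) * \<kappa> s))\<^sup>2
      - \<mu>\<^sup>2 * (u s * sin (\<psi> s - \<theta>))\<^sup>2)"
  assumes nz: "\<exists>t\<in>{0..2 * pi}. u t \<noteq> 0"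
    and u: "\<And>t. t \<in> {0..2 * pi} \<Longrightarrow> (u has_real_derivative v t) (at t within {0..2 * pi})"
    and v: "\<And>t. t \<in> {0..2 * pi} \<Longrightarrow>
      (v has_real_derivative ((\<kappa> t)\<^sup>2 - \<nu>) * u t) (at t within {0..2 * pi})"
    and per: "u 0 = u (2 * pi)" "v 0 = v (2 * pi)"
    and cont: "continuous_on {0..2 * pi} \<psi>" "continuous_on {0..2 * pi} \<kappa>"
    and less: "\<nu> < \<mu>\<^sup>2"
  obtains c where "\<And>\<theta>. \<bar>\<theta> - c\<bar> \<le> pi / 4 \<Longrightarrow> J \<theta> < 0"
proof -
  have cu: "continuous_on {0..2 * pi} u" using u by (rule DERIV_continuous_on)
  have cv: "continuous_on {0..2 * pi} v" using v by (rule DERIV_continuous_on)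
  note ci = continuous_intros cu cv cont
  \<comment> \<open>\<open>b\<close> and \<open>a\<close> are the integrands for the coordinates
    \<open>u s * sin (\<psi> s)\<close> and \<open>u s * cos (\<psi> s)\<close>, and
    \<open>d\<close> is that of their mixed term.\<close>
  define a where "a = (\<lambda>s. (v s * cos (\<psi> s) - u s * sin (\<psi> s) * \<kappa> s)\<^sup>2 - \<mu>\<^sup>2 * (u s * cos (\<psi> s))\<^sup>2)"
  define b where "b = (\<lambda>s. (v s * sin (\<psi> s) + u s * cos (\<psi> s) * \<kappa> s)\<^sup>2 - \<mu>\<^sup>2 * (u s * sin (\<psi> s))\<^sup>2)"
  define d where "d = (\<lambda>s. (v s * cos (\<psi> s) - u s * sin (\<psi> s) * \<kappa> s) *
     (v s * sin (\<psi> s) + u s * cos (\<psi> s) * \<kappa> s) - \<mu>\<^sup>2 * (u s * cos (\<psi> s)) * (u s * sin (\<psi> s)))"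
  have ia: "a integrable_on {0..2 * pi}" and ib: "b integrable_on {0..2 * pi}"
    and id: "d integrable_on {0..2 * pi}"
    unfolding a_def b_def d_def by (intro integrable_continuous_real ci)+
  let ?A = "integral {0..2 * pi} a" and ?B = "integral {0..2 * pi} b" and ?D = "integral {0..2 * pi} d"
  have J: "J \<theta> = (cos \<theta>)\<^sup>2 * ?B + (sin \<theta>)\<^sup>2 * ?A - 2 * sin \<theta> * cos \<theta> * ?D" for \<theta>
  proof -
    have "J \<theta> = integral {0..2 * pi} (\<lambda>s. (cos \<theta>)\<^sup>2 * b s + (sin \<theta>)\<^sup>2 * a s - 2 * sin \<theta> * cos \<theta> * d s)"
      unfolding J_def a_def b_def d_def
      by (intro integral_cong) (simp add: sin_diff cos_diff power2_eq_square algebra_simps)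
    also have "\<dots> = (cos \<theta>)\<^sup>2 * ?B + (sin \<theta>)\<^sup>2 * ?A - 2 * sin \<theta> * cos \<theta> * ?D"
      using integrable_on_cmult_left[OF ia, of "(sin \<theta>)\<^sup>2"] integrable_on_cmult_left[OF ib, of "(cos \<theta>)\<^sup>2"]
        integrable_on_cmult_left[OF id, of "2 * sin \<theta> * cos \<theta>"]
      by (simp add: integral_diff integral_add integrable_add)
    finally show ?thesis .
  qed
  have neg: "?A + ?B < 0"
  proof -
    \<comment> \<open>The angle drops out of the sum. By the eigenvalue equation the first bracket
      is the derivative of \<open>u s * v s\<close>, which integrates to 0 by periodicity.\<close>
    have sum: "a s + b s = (v s * v s + ((\<kappa> s)\<^sup>2 - \<nu>) * u s * u s) - (\<mu>\<^sup>2 - \<nu>) * (u s)\<^sup>2" for s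
    proof -
      have "a s + b s = ((v s)\<^sup>2 + (\<kappa> s)\<^sup>2 * (u s)\<^sup>2 - \<mu>\<^sup>2 * (u s)\<^sup>2) * ((sin (\<psi> s))\<^sup>2 + (cos (\<psi> s))\<^sup>2)"
        unfolding a_def b_def by algebra
      then show ?thesis by (simp add: power2_eq_square algebra_simps)
    qed
    have "((\<lambda>s. u s * v s) has_real_derivative (v s * v s + ((\<kappa> s)\<^sup>2 - \<nu>) * u s * u s)) (at s within {0..2 * pi})"
      if "s \<in> {0..2 * pi}" for s
      using DERIV_mult[OF u[OF that] v[OF that]] by (simp add: mult.assoc add.commute)
    then have "((\<lambda>s. v s * v s + ((\<kappa> s)\<^sup>2 - \<nu>) * u s * u s) has_integral
        u (2 * pi) * v (2 * pi) - u 0 * v 0) {0..2 * pi}"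
      by (intro fundamental_theorem_of_calculus)
        (auto simp: has_real_derivative_iff_has_vector_derivative)
    then have one: "((\<lambda>s. v s * v s + ((\<kappa> s)\<^sup>2 - \<nu>) * u s * u s) has_integral 0) {0..2 * pi}"
      using per by simp
    have iu: "(\<lambda>s. (u s)\<^sup>2) integrable_on {0..2 * pi}"
      by (intro integrable_continuous_real ci)
    have "?A + ?B = integral {0..2 * pi} (\<lambda>s. a s + b s)"
      using ia ib by (simp add: integral_add)
    also have "\<dots> = 0 - (\<mu>\<^sup>2 - \<nu>) * integral {0..2 * pi} (\<lambda>s. (u s)\<^sup>2)"
      unfolding sum
      by (intro integral_unique has_integral_diff one has_integral_mult_right integrable_integral iu)
    finally have eq: "?A + ?B = - ((\<mu>\<^sup>2 - \<nu>) * integral {0..2 * pi} (\<lambda>s. (u s)\<^sup>2))" by simp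
    have "integral {0..2 * pi} (\<lambda>s. (u s)\<^sup>2) \<noteq> 0"
    proof
      assume "integral {0..2 * pi} (\<lambda>s. (u s)\<^sup>2) = 0"
      then have "\<forall>s\<in>{0..2 * pi}. (u s)\<^sup>2 = 0"
        using integral_eq_0_iff[of 0 "2 * pi" "\<lambda>s. (u s)\<^sup>2"] cu by (simp add: continuous_on_power)
      then show False using nz by simp
    qed
    moreover have "0 \<le> integral {0..2 * pi} (\<lambda>s. (u s)\<^sup>2)"
      by (intro integral_nonneg iu) simp
    ultimately have "0 < (\<mu>\<^sup>2 - \<nu>) * integral {0..2 * pi} (\<lambda>s. (u s)\<^sup>2)"
      using less by simp
    then show ?thesis using eq by simp
  qed
  \<comment> \<open>\<open>z\<close> holds amplitude and phase of the part of \<open>J\<close> that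
    oscillates in \<open>2 * \<theta>\<close>. At \<open>c\<close> this part is minimal, and up to
    \<pi>/4 away from \<open>c\<close> it is still not positive.\<close>
  define z where "z = Complex ((?B - ?A) / 2) (- ?D)"
  define c where "c = Arg z / 2 + pi / 2"
  show thesis
  proof
    fix \<theta> assume \<theta>: "\<bar>\<theta> - c\<bar> \<le> pi / 4"
    have z: "(?B - ?A) / 2 = cmod z * cos (Arg z)" "- ?D = cmod z * sin (Arg z)"
      using rcis_cmod_Arg[of z] by (metis Re_rcis z_def complex.sel(1), metis Im_rcis z_def complex.sel(2))
    have "J \<theta> = (?A + ?B) / 2 + (?B - ?A) / 2 * cos (2 * \<theta>) + (- ?D) * sin (2 * \<theta>)"
      unfolding J cos_double sin_double sin_squared_eq by (simp add: field_simps)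
    also have "\<dots> = (?A + ?B) / 2 + cmod z * cos (2 * \<theta> - Arg z)"
      unfolding z by (simp add: cos_diff algebra_simps)
    also have "cos (2 * \<theta> - Arg z) = - cos (2 * (\<theta> - c))"
      using cos_periodic_pi[of "2 * (\<theta> - c)"] by (simp add: c_def algebra_simps)
    also have "0 \<le> cos (2 * (\<theta> - c))"
    proof (intro cos_ge_zero)
      show "- (pi / 2) \<le> 2 * (\<theta> - c)" using abs_le_D2[OF \<theta>] by simp
      show "2 * (\<theta> - c) \<le> pi / 2" using abs_le_D1[OF \<theta>] by simp
    qed
    then have "0 \<le> cmod z * cos (2 * (\<theta> - c))" by simp
    then have "(?A + ?B) / 2 + cmod z * - cos (2 * (\<theta> - c)) \<le> (?A + ?B) / 2" by linarith
    finally show "J \<theta> < 0" using neg by simp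
  qed
qed

section \<open>From the curve to the eigenvalue bound\<close>

text \<open>For a clockwise curve, \<open>\<epsilon> = -1\<close> amounts to reflection in the first
  axis, which makes it counterclockwise.\<close>

lemma turning_angleI:
  fixes \<Gamma> :: "real \<Rightarrow> real ^ 2"
  assumes closed: "smooth_closed_curve \<Gamma>"
    and angle: "tangent_angle \<Gamma> \<phi>"
    and \<phi>: "\<And>s. (\<phi> has_real_derivative \<kappa> s) (at s)"
    and \<epsilon>: "\<epsilon> \<in> {1, -1}" "\<And>s. 0 < \<epsilon> * \<kappa> s" "((\<lambda>s. \<epsilon> * \<kappa> s) has_integral 2 * pi) {0..2 * pi}"
  shows "turning_angle (\<lambda>s. \<epsilon> * \<phi> s) (\<lambda>s. \<epsilon> * \<kappa> s)"
    and "((\<lambda>s. \<Gamma> s $ 1) has_real_derivative cos (\<epsilon> * \<phi> s)) (at s)"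
    and "((\<lambda>s. \<epsilon> * \<Gamma> s $ 2) has_real_derivative sin (\<epsilon> * \<phi> s)) (at s)"
proof -
  have per: "\<Gamma> (s + 2 * pi) = \<Gamma> s" for s
    using closed by (simp add: smooth_closed_curve_def)
  have d\<Gamma>: "(\<Gamma> has_vector_derivative vector [cos (\<phi> s), sin (\<phi> s)]) (at s)" for s
    using angle by (simp add: tangent_angle_def)
  have d: "((\<lambda>s. \<Gamma> s $ i) has_real_derivative vector [cos (\<phi> s), sin (\<phi> s)] $ i) (at s)" for i s
    using bounded_linear.has_vector_derivative[OF bounded_linear_vec_nth d\<Gamma>]
    by (simp add: has_real_derivative_iff_has_vector_derivative)
  have per_deriv: "f' (s + 2 * pi) = f' s"
    if "\<And>s. (f has_real_derivative f' s) (at s)" "\<And>s. f (s + 2 * pi) = f s"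
    for f f' :: "real \<Rightarrow> real" and s
  proof -
    have "((\<lambda>s. f (s + 2 * pi)) has_real_derivative f' (s + 2 * pi)) (at s)"
      using that(1)[of "s + 2 * pi"] by (simp add: DERIV_shift)
    then have "(f has_real_derivative f' (s + 2 * pi)) (at s)" by (simp add: that(2))
    then show ?thesis using that(1) by (rule DERIV_unique)
  qed
  have c: "cos (\<phi> (s + 2 * pi)) = cos (\<phi> s)" for s
    using per_deriv[of "\<lambda>s. \<Gamma> s $ 1" "\<lambda>s. cos (\<phi> s)"] d[of 1] per by simp
  have s: "sin (\<phi> (s + 2 * pi)) = sin (\<phi> s)" for s
    using per_deriv[of "\<lambda>s. \<Gamma> s $ 2" "\<lambda>s. sin (\<phi> s)"] d[of 2] per by simp
  have ds: "((\<lambda>s. sin (\<phi> s)) has_real_derivative cos (\<phi> s) * \<kappa> s) (at s)" for s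
    by (auto intro!: derivative_eq_intros \<phi>)
  have dc: "((\<lambda>s. - cos (\<phi> s)) has_real_derivative sin (\<phi> s) * \<kappa> s) (at s)" for s
    by (auto intro!: derivative_eq_intros \<phi>)
  \<comment> \<open>Sine and cosine have no common zero, so periodicity of both products gives
    periodicity of \<open>\<kappa>\<close>.\<close>
  have c': "cos (\<phi> s) * \<kappa> (s + 2 * pi) = cos (\<phi> s) * \<kappa> s" for s
    using per_deriv[OF ds, of s] s c by simp
  have s': "sin (\<phi> s) * \<kappa> (s + 2 * pi) = sin (\<phi> s) * \<kappa> s" for s
    using per_deriv[OF dc, of s] s c by simp
  have \<kappa>: "\<kappa> (s + 2 * pi) = \<kappa> s" for s
    using c'[of s] s'[of s] by (metis mult_cancel_left sin_zero_abs_cos_one abs_zero zero_neq_one)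
  have d\<psi>: "((\<lambda>s. \<epsilon> * \<phi> s) has_real_derivative \<epsilon> * \<kappa> s) (at s)" for s
    by (auto intro!: derivative_eq_intros \<phi>)
  show "turning_angle (\<lambda>s. \<epsilon> * \<phi> s) (\<lambda>s. \<epsilon> * \<kappa> s)"
  proof
    \<comment> \<open>The increment of the angle over one period is constant because
      \<open>\<kappa>\<close> is periodic; the total turning fixes its value.\<close>
    have "((\<lambda>s. \<epsilon> * \<phi> (s + 2 * pi) - \<epsilon> * \<phi> s) has_real_derivative 0) (at s)" for s
    proof -
      have "((\<lambda>s. \<phi> (s + 2 * pi)) has_real_derivative \<kappa> (s + 2 * pi)) (at s)"
        using \<phi>[of "s + 2 * pi"] by (simp add: DERIV_shift)
      then show ?thesis
        by (auto intro!: derivative_eq_intros \<phi> simp: \<kappa>)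
    qed
    then have "\<epsilon> * \<phi> (s + 2 * pi) - \<epsilon> * \<phi> s = \<epsilon> * \<phi> (0 + 2 * pi) - \<epsilon> * \<phi> 0" for s
      using DERIV_isconst_all[of "\<lambda>s. \<epsilon> * \<phi> (s + 2 * pi) - \<epsilon> * \<phi> s" s 0] by blast
    moreover have "((\<lambda>s. \<epsilon> * \<kappa> s) has_integral \<epsilon> * \<phi> (2 * pi) - \<epsilon> * \<phi> 0) {0..2 * pi}"
      by (intro fundamental_theorem_of_calculus)
        (auto intro: has_field_derivative_at_within d\<psi> simp flip: has_real_derivative_iff_has_vector_derivative)
    then have "\<epsilon> * \<phi> (2 * pi) - \<epsilon> * \<phi> 0 = 2 * pi"
      using \<epsilon>(3) has_integral_unique by blast
    ultimately show "\<epsilon> * \<phi> (s + 2 * pi) = \<epsilon> * \<phi> s + 2 * pi" for s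
      by (simp add: algebra_simps)
  qed (use d\<psi> \<epsilon>(2) in auto)
  show "((\<lambda>s. \<Gamma> s $ 1) has_real_derivative cos (\<epsilon> * \<phi> s)) (at s)"
    using d[of 1 s] \<epsilon>(1) by auto
  show "((\<lambda>s. \<epsilon> * \<Gamma> s $ 2) has_real_derivative sin (\<epsilon> * \<phi> s)) (at s)"
    using DERIV_cmult[OF d[of 2 s], of \<epsilon>] \<epsilon>(1) by auto
qed

lemma eigenvalue_ge:
  fixes X Y \<psi> k :: "real \<Rightarrow> real"
  assumes "turning_angle \<psi> k" and ck: "continuous_on {0..2 * pi} k"
    and X: "\<And>s. (X has_real_derivative cos (\<psi> s)) (at s)"
    and Y: "\<And>s. (Y has_real_derivative sin (\<psi> s)) (at s)"
    and perX: "\<And>s. X (s + 2 * pi) = X s"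
    and perY: "\<And>s. Y (s + 2 * pi) = Y s"
    and ev: "schroedinger_eigenvalue k \<nu>"
  shows "16 / 25 \<le> \<nu>"
proof (rule ccontr)
  assume "\<not> ?thesis"
  then have \<nu>: "\<nu> < (4 / 5)\<^sup>2" by (simp add: power2_eq_square)
  interpret turning_angle \<psi> k by fact
  obtain u v where nz: "\<exists>t\<in>{0..2 * pi}. u t \<noteq> 0"
    and u: "\<And>t. t \<in> {0..2 * pi} \<Longrightarrow> (u has_real_derivative v t) (at t within {0..2 * pi})"
    and v: "\<And>t. t \<in> {0..2 * pi} \<Longrightarrow>
      (v has_real_derivative ((k t)\<^sup>2 - \<nu>) * u t) (at t within {0..2 * pi})"
    and per: "u 0 = u (2 * pi)" "v 0 = v (2 * pi)"
    using schroedinger_eigenvalueE[OF ev ck] by blast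
  have c\<psi>: "continuous_on {0..2 * pi} \<psi>"
    using isCont_\<psi> by (simp add: continuous_at_imp_continuous_on)
  have cu: "continuous_on {0..2 * pi} u" using u by (rule DERIV_continuous_on)
  have cv: "continuous_on {0..2 * pi} v" using v by (rule DERIV_continuous_on)
  let ?y = "\<lambda>\<theta> s. u s * sin (\<psi> s - \<theta>)"
  let ?y' = "\<lambda>\<theta> s. v s * sin (\<psi> s - \<theta>) + u s * (cos (\<psi> s - \<theta>) * k s)"
  obtain c where neg: "\<And>\<theta>. \<bar>\<theta> - c\<bar> \<le> pi / 4 \<Longrightarrow>
      integral {0..2 * pi} (\<lambda>s. (?y' \<theta> s)\<^sup>2 - (4/5)\<^sup>2 * (?y \<theta> s)\<^sup>2) < 0"
    by (rule negative_directions[OF nz u v per c\<psi> ck \<nu>]) (assumption | erule that)+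
  have "\<exists>\<theta>. \<bar>\<theta> - c\<bar> \<le> pi / 4 \<and> \<bar>excess \<theta>\<bar> \<le> 3 / 4"
    using X Y perX perY by (rule ex_small_excess)
  then obtain \<theta> where \<theta>: "\<bar>\<theta> - c\<bar> \<le> pi / 4" "\<bar>excess \<theta>\<bar> \<le> 3 / 4" by blast
  obtain a b where ab: "0 \<le> a" "a \<le> b" "b \<le> 2 * pi"
    and zero: "sin (\<psi> a - \<theta>) = 0" "sin (\<psi> b - \<theta>) = 0" and "\<bar>b - a - pi\<bar> = \<bar>excess \<theta>\<bar>"
    by (rule arcs_in_period)
  then have ba: "b - a \<le> pi + 3/4" "pi - 3/4 \<le> b - a" using \<theta>(2) by linarith+
  have "0 \<le> integral {0..2 * pi} (\<lambda>s. (?y' \<theta> s)\<^sup>2 - (4/5)\<^sup>2 * (?y \<theta> s)\<^sup>2)"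
  proof (rule two_zeros_bound[OF ab])
    fix s assume s: "s \<in> {0..2 * pi}"
    have "(\<psi> has_real_derivative k s) (at s within {0..2 * pi})"
      using deriv by (rule has_field_derivative_at_within)
    then have "((\<lambda>s. sin (\<psi> s - \<theta>)) has_real_derivative cos (\<psi> s - \<theta>) * k s) (at s within {0..2 * pi})"
      by (auto intro!: derivative_eq_intros)
    from DERIV_mult[OF u[OF s] this]
    show "(?y \<theta> has_real_derivative ?y' \<theta> s) (at s within {0..2 * pi})"
      by (simp add: mult.commute)
  next
    show "continuous_on {0..2 * pi} (?y' \<theta>)"
      by (intro continuous_intros cu cv ck c\<psi>)
    have "\<psi> (2 * pi) - \<theta> = \<psi> 0 - \<theta> + 2 * pi" using turn[of 0] by simp
    then show "(?y \<theta> 0)\<^sup>2 = (?y \<theta> (2 * pi))\<^sup>2"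
      by (simp only: sin_periodic per(1))
    \<comment> \<open>Both arcs have length at most \<pi> + 3/4. The constant 3/4 is admissible
      because it is less than \<pi>/4, the amount by which \<pi>/(4/5) exceeds \<pi>.\<close>
    show "4/5 * (b - a) < pi" "4/5 * (2 * pi - (b - a)) < pi"
      using ba pi_approx(1) by (simp_all add: algebra_simps)
  qed (use zero in auto)
  then show False using neg[OF \<theta>(1)] by simp
qed

theorem theorem2p1:
  fixes \<Gamma> :: "real \<Rightarrow> real ^ 2" and \<phi> \<kappa> :: "real \<Rightarrow> real" and lam :: real
  assumes "smooth_closed_curve \<Gamma>"
    and "tangent_angle \<Gamma> \<phi>"
    and "\<And>s. (\<phi> has_real_derivative \<kappa> s) (at s)"
    and "strictly_convex \<kappa>"
    and "lowest_eigenvalue \<kappa> lam"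
  shows "lam > (1 + 1 / (1 + 8 / pi)) powi (-2) \<and>
         (1 + 1 / (1 + 8 / pi)) powi (-2) > (0.6084 :: real)"
proof -
  obtain \<epsilon> :: real where \<epsilon>: "\<epsilon> \<in> {1, -1}" "\<And>s. 0 < \<epsilon> * \<kappa> s"
      "((\<lambda>s. \<epsilon> * \<kappa> s) has_integral 2 * pi) {0..2 * pi}"
    using assms(4) unfolding strictly_convex_def by blast
  note ta = turning_angleI[OF assms(1-3) \<epsilon>]
  \<comment> \<open>Smoothness of the angle at order 1 yields continuity of the curvature.\<close>
  have "((\<lambda>g t. vector_derivative g (at t)) ^^ 1) \<phi> differentiable_on UNIV"
    using assms(2) unfolding tangent_angle_def C_infinity_def by blast
  moreover have "((\<lambda>g t. vector_derivative g (at t)) ^^ 1) \<phi> = \<kappa>"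
    using assms(3) by (auto simp: has_real_derivative_iff_has_vector_derivative
      intro!: vector_derivative_at)
  ultimately have "continuous_on UNIV \<kappa>" by (simp add: differentiable_imp_continuous_on)
  then have ck: "continuous_on {0..2 * pi} (\<lambda>s. \<epsilon> * \<kappa> s)"
    by (intro continuous_intros) (auto intro: continuous_on_subset)
  \<comment> \<open>The operator contains only the square of the curvature, so a change of
    orientation does not affect it.\<close>
  have "(\<lambda>s. (\<epsilon> * \<kappa> s)\<^sup>2) = (\<lambda>s. (\<kappa> s)\<^sup>2)" using \<epsilon>(1) by (auto simp: power_mult_distrib)
  then have "schroedinger (\<lambda>s. \<epsilon> * \<kappa> s) = schroedinger \<kappa>"
    unfolding schroedinger_def fun_eq_iff by simp
  then have ev: "schroedinger_eigenvalue (\<lambda>s. \<epsilon> * \<kappa> s) lam"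
    using assms(5) by (simp add: lowest_eigenvalue_def schroedinger_eigenvalue_def)
  have "16 / 25 \<le> lam"
    by (rule eigenvalue_ge[OF ta(1) ck ta(2,3) _ _ ev])
      (use assms(1) in \<open>simp_all add: smooth_closed_curve_def\<close>)
  define x where "x = 1 + 1 / (1 + 8 / pi)"
  \<comment> \<open>The bound 3 corresponds to \<open>x > 5 / 4\<close>, and 28/11 to
    \<open>x < 50 / 39\<close>; the square of 39/50 is exactly 0.6084.\<close>
  have "28 / 11 < 8 / pi" "8 / pi < 3"
    using pi_approx by (simp_all add: field_simps)
  then have x: "5 / 4 < x" "x < 50 / 39"
    unfolding x_def by (simp_all add: field_simps)
  have "x powi (-2) = 1 / x\<^sup>2" by (simp add: power_int_minus field_simps)
  moreover have "(5/4)\<^sup>2 < x\<^sup>2" "x\<^sup>2 < (50/39)\<^sup>2"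
    using x by (auto intro!: power_strict_mono)
  then have "1 / x\<^sup>2 < 16 / 25" "6084 / 10000 < 1 / x\<^sup>2"
    using x by (simp_all add: power2_eq_square field_simps)
  ultimately show ?thesis using \<open>16 / 25 \<le> lam\<close> by (simp add: x_def)
qed

end
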